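(* Let $G$ be a convex geometric graph. If $G$ is convex-packable, then there exists a function $f:E(G)\to\mathbb{R}^+$ satisfying the following two conditions: (i) every set of edges $S\subseteq E(G)$ satisfies $\sum_{e\in S} f(e)\ge |S|^2/(4e(G))$; and (ii) every convex set of edges $A\subseteq E(G)$ satisfies $\sum_{e\in A} f(e)\le 1$.
   Context: Graphs are finite and simple; $e(G)$ is the number of edges of $G$; $\mathbb{R}^+$ is the set of positive reals. A convex geometric graph (CGG) is a graph whose vertices are points in strictly convex position in the Euclidean plane and whose edges are straight line segments joining vertices. Its vertices $v_0,\dots,v_{n-1}$ are listed in clockwise cyclic order on the boundary of their convex hull (indices modulo $n$). A pair $\{v_i,v_{i+1}\}$ is an extremal pair. The length $\ell(x,y)$ of a pair of vertices is the minimum length of a path from $x$ to $y$ using only extremal pairs. CGGs $G_1,G_2$ are convex-isomorphic if there is a bijection $f:V(G_1)\to V(G_2)$ such that for all $x,y\in V(G_1)$: $\ell(x,y)=\ell(f(x),f(y))$ (lengths taken in $G_1$, resp. $G_2$), and $\{x,y\}\in E(G_1)$ if and only if $\{f(x),f(y)\}\in E(G_2)$. A subgraph of a CGG is regarded as a CGG on its own vertex set with the induced cyclic order. Let $\mathcal{K}_n$ be the complete CGG on $n$ vertices. A $G$-packing of $\mathcal{K}_n$ is a collection of pairwise edge-disjoint subgraphs of $\mathcal{K}_n$, each convex-isomorphic to $G$; $p(n,G)$ is the maximum size of such a packing. $G$ is convex-packable if $\lim_{n\to\infty} p(n,G)\,e(G)/\binom n2=1$, i.e. there are $G$-packings of $\mathcal{K}_n$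 covering all but $o(n^2)$ edges. A set of edges $\{e_1,\dots,e_k\}$ of a CGG is convex if for each edge $e_i$, all other edges $e_j$ lie on the same side of the line determined by $e_i$ (that is, in one common closed half-plane bounded by that line; sharing endpoints with $e_i$ is allowed). *)

theory Defs
  imports "HOL-Analysis.Analysis"
begin

type_synonym point = "real ^ 2"

record geo_graph =
  verts :: "point set"
  edges :: "point set set"

definition strictly_convex_position :: "point set \<Rightarrow> bool" where
  "strictly_convex_position V \<longleftrightarrow> (\<forall>v\<in>V. v \<notin> convex hull (V - {v}))"

definition all_pairs :: "point set \<Rightarrow> point set set" where
  "all_pairs V = {{x, y} | x y. x \<in> V \<and> y \<in> V \<and> x \<noteq> y}"

text \<open>An edge is given by its two endpoints; as a straight line segment it is the convex hull of
  that set.\<close>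

definition cgg :: "geo_graph \<Rightarrow> bool" where
  "cgg G \<longleftrightarrow> finite (verts G) \<and> strictly_convex_position (verts G) \<and> edges G \<subseteq> all_pairs (verts G)"

text \<open>Twice the signed area of the triangle \<open>a b c\<close>, negative iff \<open>a, b, c\<close> is a clockwise turn.\<close>

definition signed_area :: "point \<Rightarrow> point \<Rightarrow> point \<Rightarrow> real" where
  "signed_area a b c = (b $ 1 - a $ 1) * (c $ 2 - a $ 2) - (b $ 2 - a $ 2) * (c $ 1 - a $ 1)"

text \<open>For points in strictly convex position, a listing follows the boundary of the convex hull
  clockwise (once around, from an arbitrary starting vertex) iff every three points, taken in
  listing order, turn clockwise. On at most two points every listing qualifies.\<close>

definition clockwise_listing :: "point set \<Rightarrow> point list \<Rightarrow> bool" where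
  "clockwise_listing V vs \<longleftrightarrow> distinct vs \<and> set vs = V \<and>
     (\<forall>i j k. i < j \<and> j < k \<and> k < length vs \<longrightarrow> signed_area (vs ! i) (vs ! j) (vs ! k) < 0)"

definition extremal_pairs :: "point set \<Rightarrow> point set set" where
  "extremal_pairs V = {{vs ! i, vs ! (Suc i mod length vs)} | vs i.
     clockwise_listing V vs \<and> i < length vs \<and> length vs \<ge> 2}"

definition cyc_length :: "point set \<Rightarrow> point \<Rightarrow> point \<Rightarrow> nat" where
  "cyc_length V x y = (LEAST k. (x, y) \<in> {(u, w). {u, w} \<in> extremal_pairs V} ^^ k)"

definition convex_isomorphic :: "geo_graph \<Rightarrow> geo_graph \<Rightarrow> bool" where
  "convex_isomorphic G H \<longleftrightarrow> (\<exists>f. bij_betw f (verts G) (verts H) \<and>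
     (\<forall>x\<in>verts G. \<forall>y\<in>verts G.
        cyc_length (verts G) x y = cyc_length (verts H) (f x) (f y) \<and>
        ({x, y} \<in> edges G \<longleftrightarrow> {f x, f y} \<in> edges H)))"

definition cgg_subgraph :: "geo_graph \<Rightarrow> geo_graph \<Rightarrow> bool" where
  "cgg_subgraph H G \<longleftrightarrow> cgg H \<and> verts H \<subseteq> verts G \<and> edges H \<subseteq> edges G"

text \<open>The complete CGG on \<open>n\<close> vertices is unique up to convex-isomorphism; it is realised here on
  the vertices of a regular \<open>n\<close>-gon.\<close>

definition regular_polygon :: "nat \<Rightarrow> point set" where
  "regular_polygon n =
     (\<lambda>k. vector [cos (2 * pi * real k / real n), sin (2 * pi * real k / real n)]) ` {..<n}"

definition complete_cgg :: "nat \<Rightarrow> geo_graph" where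
  "complete_cgg n = \<lparr>verts = regular_polygon n, edges = all_pairs (regular_polygon n)\<rparr>"

definition is_packing :: "geo_graph \<Rightarrow> nat \<Rightarrow> geo_graph set \<Rightarrow> bool" where
  "is_packing G n P \<longleftrightarrow>
     (\<forall>H\<in>P. cgg_subgraph H (complete_cgg n) \<and> convex_isomorphic H G) \<and>
     (\<forall>H\<in>P. \<forall>H'\<in>P. H \<noteq> H' \<longrightarrow> edges H \<inter> edges H' = {})"

definition packing_number :: "nat \<Rightarrow> geo_graph \<Rightarrow> nat" where
  "packing_number n G = Max (card ` {P. is_packing G n P})"

definition convex_packable :: "geo_graph \<Rightarrow> bool" where
  "convex_packable G \<longleftrightarrow>
     (\<lambda>n. real (packing_number n G) * real (card (edges G)) / real (n choose 2)) \<longlonglongrightarrow> 1"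

text \<open>\<open>a\<close> and \<open>b\<close> describe one of the two closed half-planes bounded by the line through \<open>e\<close>.\<close>

definition convex_edge_set :: "point set set \<Rightarrow> bool" where
  "convex_edge_set A \<longleftrightarrow> (\<forall>e\<in>A. \<exists>a b. a \<noteq> 0 \<and> affine hull e = {z. a \<bullet> z = b} \<and>
     (\<forall>e'\<in>A - {e}. convex hull e' \<subseteq> {z. a \<bullet> z \<le> b}))"

end

theory Submission
  imports Defs
begin

text \<open>Take a maximum packing of the complete convex geometric graph on \<open>n\<close> vertices and let \<open>f_n e\<close> be
  the average, over the copies of \<open>G\<close>, of the length of the image of \<open>e\<close> divided by \<open>n\<close>. A
  convex-isomorphism preserves pairs of length 1 and hence the orientation of triples up to a global
  sign, so the images of a convex set of edges cut off disjoint boundary arcs and have total length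
  at most \<open>n\<close>. The images of the edges in \<open>S\<close> are about \<open>|S| n\<^sup>2 / (2 e(G))\<close> distinct pairs,
  of which only \<open>n\<close> can have any given length; this bounds their total length from below. A
  subsequence of \<open>f_n\<close> converges to the required \<open>f\<close>.\<close>

section \<open>Orientation of point triples and clockwise listings\<close>

lemma signed_area_rot: "signed_area b c a = signed_area a b c"
  by (simp add: signed_area_def algebra_simps)

lemma signed_area_swap: "signed_area b a c = - signed_area a b c"
  by (simp add: signed_area_def algebra_simps)

lemma signed_area_degenerate [simp]:
  "signed_area a a b = 0" "signed_area a b a = 0" "signed_area a b b = 0"
  by (simp_all add: signed_area_def algebra_simps)

text \<open>Rotating or swapping arguments changes both sides by the same sign, so any triple of
  distinct indices reduces to an increasing one. A repeated index makes both sides zero.\<close>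

lemma signed_area_sgn_cong:
  assumes base: "\<And>i j l. \<lbrakk>i < j; j < l; l < k\<rbrakk> \<Longrightarrow>
      sgn (signed_area (v i) (v j) (v l)) = c * sgn (signed_area (u i) (u j) (u l))"
    and "i < k" "j < k" "l < (k::nat)"
  shows "sgn (signed_area (v i) (v j) (v l)) = c * sgn (signed_area (u i) (u j) (u l))"
proof -
  have rot: "sgn (signed_area (v j) (v l) (v i)) = c * sgn (signed_area (u j) (u l) (u i))
      \<Longrightarrow> sgn (signed_area (v i) (v j) (v l)) = c * sgn (signed_area (u i) (u j) (u l))" for i j l
    by (simp add: signed_area_rot)
  have swap: "sgn (signed_area (v j) (v i) (v l)) = c * sgn (signed_area (u j) (u i) (u l))
      \<Longrightarrow> sgn (signed_area (v i) (v j) (v l)) = c * sgn (signed_area (u i) (u j) (u l))" for i j l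
    by (simp add: signed_area_swap[of "v j"] signed_area_swap[of "u j"] sgn_minus)
  have inc: "sgn (signed_area (v i) (v j) (v l)) = c * sgn (signed_area (u i) (u j) (u l))"
    if "i < j" "i < l" "i < k" "j < k" "l < k" for i j l
  proof (cases j l rule: linorder_cases)
    case greater
    show ?thesis
      by (rule swap, rule rot, rule base) (use that greater in auto)
  qed (use base that in auto)
  consider "i = j \<or> j = l \<or> i = l" | "i < j" "i < l" | "j < i" "j < l" | "l < i" "l < j"
    by linarith
  then show ?thesis
  proof cases
    case 3
    show ?thesis by (rule rot, rule inc) (use 3 assms in auto)
  next
    case 4
    show ?thesis by (rule rot, rule rot, rule inc) (use 4 assms in auto)
  qed (use inc assms in auto)
qed

section \<open>Vertices of the regular polygon\<close>

definition polygon_vertex :: "nat \<Rightarrow> nat \<Rightarrow> point" where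
  "polygon_vertex n k = vector [cos (2 * pi * real k / real n), sin (2 * pi * real k / real n)]"

lemma regular_polygon_eq: "regular_polygon n = polygon_vertex n ` {..<n}"
  by (simp add: regular_polygon_def polygon_vertex_def)

lemma inj_on_polygon_vertex: "inj_on (polygon_vertex n) {..<n}"
proof (rule inj_onI)
  fix i j assume ij: "i \<in> {..<n}" "j \<in> {..<n}" and eq: "polygon_vertex n i = polygon_vertex n j"
  let ?a = "2 * pi * real i / real n" and ?b = "2 * pi * real j / real n"
  have "sin ?a = sin ?b \<and> cos ?a = cos ?b"
    using arg_cong[OF eq, of "\<lambda>p. p $ 1"] arg_cong[OF eq, of "\<lambda>p. p $ 2"]
    by (simp add: polygon_vertex_def)
  then obtain m :: int where "?a = ?b + 2 * pi * m"
    unfolding sin_cos_eq_iff by (auto simp: Ints_def)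
  then have "2 * pi * real i = 2 * pi * (real j + m * real n)"
    using ij by (simp add: field_simps)
  then have "real i = real j + m * real n" by simp
  then have *: "int i = int j + m * int n"
    by (metis (mono_tags, opaque_lifting) of_int_add of_int_eq_iff of_int_mult of_int_of_nat_eq)
  then have "int i mod int n = int j mod int n" by simp
  then show "i = j" using ij by simp
qed

text \<open>In terms of the half angles \<open>u\<close> and \<open>v\<close> between consecutive
  points of the triple, the signed area is \<open>4 * sin u * sin v * sin (u + v)\<close>. All three
  angles lie strictly between 0 and pi.\<close>

lemma signed_area_polygon:
  assumes "i < j" "j < l" "l < n"
  shows "signed_area (polygon_vertex n i) (polygon_vertex n j) (polygon_vertex n l) > 0"
proof -
  define a u v where "a = 2 * pi * real i / real n"
    and "u = pi * (real j - real i) / real n" and "v = pi * (real l - real j) / real n"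
  have n: "real n > 0" using assms by simp
  have b: "2 * pi * real j / real n = a + 2 * u" and c: "2 * pi * real l / real n = a + 2 * (u + v)"
    using n by (simp_all add: a_def u_def v_def field_simps)
  have "signed_area (polygon_vertex n i) (polygon_vertex n j) (polygon_vertex n l) =
     sin (2 * u) + sin (2 * (u + v) - 2 * u) - sin (2 * (u + v))"
  proof -
    have id: "(cb - ca) * (sc - sa) - (sb - sa) * (cc - ca) =
       (sb * ca - cb * sa) + (sc * cb - cc * sb) - (sc * ca - cc * sa)"
      for ca sa cb sb cc sc :: real by (simp add: algebra_simps)
    show ?thesis
      unfolding signed_area_def polygon_vertex_def b c a_def[symmetric] vector_2 id
      by (simp add: sin_diff[symmetric])
  qed
  also have "\<dots> = 4 * sin u * sin v * sin (u + v)"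
  proof -
    have "sin (2 * u) + sin (2 * v) - sin (2 * (u + v)) = 
       2 * sin u * cos u + 2 * sin v * cos v - 2 * (sin u * cos v + cos u * sin v) * (cos u * cos v - sin u * sin v)"
      by (simp only: sin_double sin_add cos_add mult.assoc)
    \<comment> \<open>The inserted factors equal 1 and make every term of degree four in the sines
      and cosines, so that the next step is pure polynomial algebra.\<close>
    also have "\<dots> = 2 * sin u * cos u * ((sin v)\<^sup>2 + (cos v)\<^sup>2) + 2 * sin v * cos v * ((sin u)\<^sup>2 + (cos u)\<^sup>2)
        - 2 * (sin u * cos v + cos u * sin v) * (cos u * cos v - sin u * sin v)"
      by simp
    also have "\<dots> = 4 * sin u * sin v * (sin u * cos v + cos u * sin v)"
      by (simp add: power2_eq_square algebra_simps del: sin_cos_squared_add sin_cos_squared_add2 sin_cos_squared_add3)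
    finally show ?thesis by (simp add: sin_add)
  qed
  also have "\<dots> > 0"
  proof -
    have "0 < u" "0 < v" using assms by (simp_all add: u_def v_def)
    moreover have "u + v < pi"
    proof -
      have "pi * real l < pi * (real i + real n)"
        using assms by (intro mult_strict_left_mono) auto
      moreover have "u + v = (pi * real l - pi * real i) / real n"
        by (simp add: u_def v_def algebra_simps flip: add_divide_distrib)
      ultimately show ?thesis using n by (simp add: pos_divide_less_eq algebra_simps)
    qed
    ultimately show ?thesis by (simp add: sin_gt_zero)
  qed
  finally show ?thesis .
qed

text \<open>Increasing indices run counterclockwise around the polygon, so the sorted list of
  indices has to be reversed.\<close>

lemma clockwise_listing_of_polygon_subset:
  assumes "W \<subseteq> regular_polygon n"
  shows "\<exists>ws. clockwise_listing W ws"
proof -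
  obtain I where I: "I \<subseteq> {..<n}" "W = polygon_vertex n ` I"
    using assms unfolding regular_polygon_eq by (meson subset_imageE)
  have fin: "finite I" using I finite_subset by blast
  define xs where "xs = sorted_list_of_set I"
  have xs: "sorted_wrt (<) xs" "set xs = I" "distinct xs"
    using fin by (auto simp: xs_def)
  define ws where "ws = rev (map (polygon_vertex n) xs)"
  have "inj_on (polygon_vertex n) I"
    using inj_on_polygon_vertex I(1) by (rule inj_on_subset)
  then have "distinct ws" using xs by (simp add: ws_def distinct_map)
  moreover have "set ws = W" using xs I by (simp add: ws_def)
  moreover have "signed_area (ws ! i) (ws ! j) (ws ! k) < 0" if "i < j" "j < k" "k < length ws" for i j k
  proof -
    let ?m = "length xs"
    have m: "length ws = ?m" by (simp add: ws_def)
    have ws: "ws ! t = polygon_vertex n (xs ! (?m - Suc t))" if "t < ?m" for t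
      using that by (simp add: ws_def rev_nth)
    have "xs ! (?m - Suc k) < xs ! (?m - Suc j)" "xs ! (?m - Suc j) < xs ! (?m - Suc i)"
      using sorted_wrt_nth_less[OF xs(1), of "?m - Suc k" "?m - Suc j"]
        sorted_wrt_nth_less[OF xs(1), of "?m - Suc j" "?m - Suc i"] that m by simp_all
    moreover have "xs ! (?m - Suc i) < n"
      using xs(2) I(1) that m by (metis diff_Suc_less in_mono lessThan_iff nth_mem length_pos_if_in_set less_nat_zero_code neq0_conv)
    ultimately have "signed_area (ws ! k) (ws ! j) (ws ! i) > 0"
      using signed_area_polygon that m by (simp add: ws)
    then show ?thesis
      by (metis neg_less_0_iff_less signed_area_rot signed_area_swap)
  qed
  ultimately show ?thesis unfolding clockwise_listing_def by blast
qed

section \<open>Extremal pairs and lengths\<close>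

lemma clockwise_listingD:
  assumes "clockwise_listing V vs"
  shows "distinct vs" "set vs = V"
    "\<And>i j k. \<lbrakk>i < j; j < k; k < length vs\<rbrakk> \<Longrightarrow> signed_area (vs ! i) (vs ! j) (vs ! k) < 0"
  using assms unfolding clockwise_listing_def by blast+

text \<open>The triple is a cyclic rotation of one in listing order, also for the pair that closes
  the cycle, and rotation preserves the signed area.\<close>

lemma clockwise_listing_extremal_side:
  assumes "clockwise_listing V vs" "i < length vs" "z \<in> V"
    "z \<noteq> vs ! i" "z \<noteq> vs ! (Suc i mod length vs)"
  shows "signed_area (vs ! i) (vs ! (Suc i mod length vs)) z < 0"
proof -
  note cl = clockwise_listingD[OF assms(1)]
  obtain k where k: "k < length vs" "z = vs ! k" 
    using assms(3) cl(2) by (metis in_set_conv_nth)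
  show ?thesis
  proof (cases "Suc i < length vs")
    case True
    then have "k < i \<or> Suc i < k" 
      using k assms by (metis linorder_neqE_nat mod_less not_less_eq)
    then show ?thesis
      using cl(3)[of k i "Suc i"] cl(3)[of i "Suc i" k] True k
      by (auto simp: signed_area_rot[of "vs ! i" "vs ! Suc i"])
  next
    case False
    then have i: "Suc i = length vs" using assms(2) by simp
    then have "0 < k" "k < i"
      using k assms(4,5) by (metis gr0I mod_self, metis less_SucE)
    then have "signed_area (vs ! 0) (vs ! k) (vs ! i) < 0"
      using cl(3) assms(2) by blast
    then show ?thesis using i k by (simp add: signed_area_rot[of "vs ! i" "vs ! 0"] signed_area_rot[of "vs ! k" "vs ! i"])
  qed
qed

text \<open>A vertex strictly after \<open>vs ! a\<close> and before \<open>vs ! b\<close> in cyclic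
  order would form a triple turning the wrong way. With the preceding lemma this describes
  consecutive vertices by sides alone, so any two listings have the same consecutive pairs.\<close>

lemma clockwise_listing_side_imp_consecutive:
  assumes "clockwise_listing V vs" "a < length vs" "b < length vs" "a \<noteq> b"
    and side: "\<And>z. \<lbrakk>z \<in> V; z \<noteq> vs ! a; z \<noteq> vs ! b\<rbrakk> \<Longrightarrow> signed_area (vs ! a) (vs ! b) z < 0"
  shows "b = Suc a mod length vs"
proof -
  note cl = clockwise_listingD[OF assms(1)]
  have side': "signed_area (vs ! a) (vs ! b) (vs ! k) < 0" if "k < length vs" "k \<noteq> a" "k \<noteq> b" for k
    using side[of "vs ! k"] that assms cl by (metis nth_eq_iff_index_eq nth_mem)
  show ?thesis
  proof (cases "a < b")
    case True
    have "\<not> Suc a < b"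
    proof
      assume "Suc a < b"
      then have "signed_area (vs ! a) (vs ! Suc a) (vs ! b) < 0" using cl(3) assms by blast
      moreover have "signed_area (vs ! a) (vs ! b) (vs ! Suc a) < 0"
        using side'[of "Suc a"] \<open>Suc a < b\<close> assms by simp
      ultimately show False
        using signed_area_rot[of "vs ! a" "vs ! Suc a" "vs ! b"]
          signed_area_swap[of "vs ! b" "vs ! a" "vs ! Suc a"] by linarith
    qed
    then show ?thesis using True assms by simp
  next
    case False
    then have ba: "b < a" using assms by simp
    have "\<not> Suc a < length vs"
    proof
      assume *: "Suc a < length vs"
      then have "signed_area (vs ! b) (vs ! a) (vs ! Suc a) < 0" using cl(3) ba by blast
      moreover have "signed_area (vs ! a) (vs ! b) (vs ! Suc a) < 0"
        using side'[of "Suc a"] * ba by simp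
      ultimately show False by (simp add: signed_area_swap[of "vs ! b"])
    qed
    moreover have "b = 0"
    proof (rule ccontr)
      assume "b \<noteq> 0"
      then have "signed_area (vs ! 0) (vs ! b) (vs ! a) < 0" using cl(3) ba assms by blast
      moreover have "signed_area (vs ! a) (vs ! b) (vs ! 0) < 0"
        using side'[of 0] \<open>b \<noteq> 0\<close> ba assms(2) by linarith
      ultimately show False 
        using signed_area_rot[of "vs ! b" "vs ! a" "vs ! 0"]
          signed_area_swap[of "vs ! b" "vs ! a" "vs ! 0"] by linarith
    qed
    ultimately show ?thesis using assms by (metis Suc_lessI mod_self)
  qed
qed

text \<open>The definition of \<open>extremal_pairs\<close> ranges over all listings, but one listing yields them all.\<close>

lemma extremal_pairs_eq:
  assumes vs: "clockwise_listing V vs" and "length vs \<ge> 2"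
  shows "extremal_pairs V = {{vs ! i, vs ! (Suc i mod length vs)} | i. i < length vs}"
proof (intro equalityI subsetI)
  fix e assume "e \<in> extremal_pairs V"
  then obtain us i where us: "clockwise_listing V us" "i < length us" "length us \<ge> 2"
    and e: "e = {us ! i, us ! (Suc i mod length us)}"
    unfolding extremal_pairs_def by blast
  let ?j = "Suc i mod length us"
  have j: "?j < length us" "?j \<noteq> i" 
    using us by (auto simp: mod_Suc)
  obtain a where a: "a < length vs" "vs ! a = us ! i" 
    using us vs by (metis clockwise_listingD(2) in_set_conv_nth nth_mem)
  obtain b where b: "b < length vs" "vs ! b = us ! ?j"
    using us vs j by (metis clockwise_listingD(2) in_set_conv_nth nth_mem)
  have "a \<noteq> b"
    using a b j us clockwise_listingD(1)[OF us(1)] by (metis nth_eq_iff_index_eq)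
  moreover have "signed_area (vs ! a) (vs ! b) z < 0" if "z \<in> V" "z \<noteq> vs ! a" "z \<noteq> vs ! b" for z
    using clockwise_listing_extremal_side[OF us(1,2)] that a b by simp
  ultimately have "b = Suc a mod length vs" 
    using clockwise_listing_side_imp_consecutive[OF vs] a b by blast
  then show "e \<in> {{vs ! i, vs ! (Suc i mod length vs)} | i. i < length vs}"
    using a b e by (intro CollectI exI[of _ a]) simp
qed (use assms in \<open>auto simp: extremal_pairs_def\<close>)

lemma extremal_pairs_iff:
  assumes "clockwise_listing V vs" "length vs \<ge> 2" "i < length vs" "j < length vs"
  shows "{vs ! i, vs ! j} \<in> extremal_pairs V \<longleftrightarrow>
    j = Suc i mod length vs \<or> i = Suc j mod length vs"
proof -
  have "0 < length vs" using assms by auto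
  then have "Suc t mod length vs < length vs" for t by simp
  then show ?thesis
    unfolding extremal_pairs_eq[OF assms(1,2)] using assms clockwise_listingD(1)[OF assms(1)]
    by (auto simp: doubleton_eq_iff nth_eq_iff_index_eq)
qed

text \<open>This ensures that the \<open>LEAST\<close> in \<open>cyc_length\<close> is attained.
  Every vertex is reached from \<open>vs ! 0\<close> along the listing, and the relation is
  symmetric.\<close>

lemma extremal_pairs_connected:
  assumes vs: "clockwise_listing V vs" and len: "length vs \<ge> 2" and "x \<in> V" "y \<in> V"
  shows "\<exists>k. (x, y) \<in> {(u, w). {u, w} \<in> extremal_pairs V} ^^ k"
proof -
  let ?R = "{(u, w). {u, w} \<in> extremal_pairs V}"
  have "sym ?R" by (auto simp: sym_def insert_commute)
  have *: "(vs ! 0, vs ! i) \<in> ?R\<^sup>*" if "i < length vs" for i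
    using that
  proof (induction i)
    case (Suc i)
    have "(vs ! i, vs ! Suc i) \<in> ?R"
      using Suc extremal_pairs_iff[OF vs len, of i "Suc i"] by simp
    with Suc show ?case by (meson Suc_lessD rtrancl.rtrancl_into_rtrancl)
  qed simp
  obtain i j where "i < length vs" "j < length vs" "x = vs ! i" "y = vs ! j"
    using assms clockwise_listingD(2)[OF vs] by (metis in_set_conv_nth)
  then have "(x, y) \<in> ?R\<^sup>*"
    using *[of i] *[of j] symD[OF sym_rtrancl[OF \<open>sym ?R\<close>]] by (meson rtrancl_trans)
  then show ?thesis by (simp add: rtrancl_power)
qed

text \<open>Extremal pairs can thus be read off from the lengths, which are what a
  convex-isomorphism preserves.\<close>

lemma cyc_length_eq_1_iff:
  assumes "clockwise_listing V vs" "length vs \<ge> 2" "x \<in> V" "y \<in> V" "x \<noteq> y"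
  shows "cyc_length V x y = 1 \<longleftrightarrow> {x, y} \<in> extremal_pairs V"
proof
  assume "cyc_length V x y = 1"
  then show "{x, y} \<in> extremal_pairs V"
    using LeastI_ex[OF extremal_pairs_connected[OF assms(1-4)]]
    unfolding cyc_length_def[symmetric] by simp
next
  assume "{x, y} \<in> extremal_pairs V"
  then show "cyc_length V x y = 1"
    unfolding cyc_length_def
  proof (intro Least_equality)
    fix k assume "(x, y) \<in> {(u, w). {u, w} \<in> extremal_pairs V} ^^ k"
    then show "1 \<le> k" using assms(5) by (cases k) auto
  qed simp
qed

text \<open>No walk joins distinct points here, so \<open>cyc_length\<close> takes the default value
  of \<open>LEAST\<close> on the empty predicate. What matters is that this value is the same for
  all such pairs.\<close>

lemma cyc_length_no_extremal_pairs:
  assumes "extremal_pairs V = {}" "x \<noteq> y"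
  shows "cyc_length V x y = (LEAST k. False)"
proof -
  have "(x, y) \<notin> {(u, w). {u, w} \<in> extremal_pairs V} ^^ k" for k
    using assms by (cases k) auto
  then show ?thesis unfolding cyc_length_def by simp
qed

text \<open>An injective walk on a cycle cannot turn back, since it would revisit the vertex before
  the last one. Its first step therefore fixes the direction of all later steps.\<close>

lemma cyclic_walk_cases:
  fixes g :: "nat \<Rightarrow> nat"
  assumes inj: "inj_on g {..<k}" and lt: "\<And>i. i < k \<Longrightarrow> g i < k"
    and step: "\<And>i. Suc i < k \<Longrightarrow> g (Suc i) = Suc (g i) mod k \<or> g i = Suc (g (Suc i)) mod k"
  shows "(\<forall>i. Suc i < k \<longrightarrow> g (Suc i) = Suc (g i) mod k) \<or>
    (\<forall>i. Suc i < k \<longrightarrow> g i = Suc (g (Suc i)) mod k)"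
proof -
  have suc_inj: "a = b" if "a < k" "b < k" "Suc a mod k = Suc b mod k" for a b
    using that by (auto simp: mod_Suc split: if_splits)
  have ne: "g (Suc (Suc i)) \<noteq> g i" if "Suc (Suc i) < k" for i
    using inj_onD[OF inj, of "Suc (Suc i)" i] that by auto
  consider "k \<le> 1" | "1 < k" "g 1 = Suc (g 0) mod k" | "1 < k" "g 0 = Suc (g 1) mod k"
    using step[of 0] by fastforce
  then show ?thesis
  proof cases
    case 2
    have "g (Suc i) = Suc (g i) mod k" if "Suc i < k" for i
      using that
    proof (induction i)
      case (Suc i)
      then have "g (Suc i) = Suc (g i) mod k" by simp
      moreover have "g i < k" "g (Suc (Suc i)) < k" using lt Suc.prems by auto
      ultimately show ?case
        using step[OF Suc.prems] ne[OF Suc.prems] suc_inj[of "g i" "g (Suc (Suc i))"] by auto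
    qed (use 2 in simp)
    then show ?thesis by blast
  next
    case 3
    have "g i = Suc (g (Suc i)) mod k" if "Suc i < k" for i
      using that
    proof (induction i)
      case (Suc i)
      then have "g i = Suc (g (Suc i)) mod k" by simp
      then show ?case using step[OF Suc.prems] ne[OF Suc.prems] by auto
    qed (use 3 in simp)
    then show ?thesis by blast
  qed auto
qed

text \<open>The map \<open>g\<close> is the shift by \<open>g 0\<close> modulo \<open>k\<close>. It
  sends increasing triples to cyclically increasing ones, and the signed area is invariant under
  cyclic rotation.\<close>

lemma signed_area_rotated_listing:
  assumes vs: "clockwise_listing V vs" and k: "k = length vs"
    and g: "\<And>i. Suc i < k \<Longrightarrow> g (Suc i) = Suc (g i) mod k" "g 0 < k"
    and ijl: "i < j" "j < l" "l < k"
  shows "signed_area (vs ! g i) (vs ! g j) (vs ! g l) < 0"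
proof -
  have g_eq: "g i = (if g 0 + i < k then g 0 + i else g 0 + i - k)" if "i < k" for i
    using that
  proof (induction i)
    case (Suc i)
    then show ?case using g(1)[of i] g(2) by (auto simp: mod_Suc split: if_splits)
  qed (use g in simp)
  note cl = clockwise_listingD(3)[OF vs]
  consider "g i < g j" "g j < g l" | "g l < g i" "g i < g j" | "g j < g l" "g l < g i"
    using g_eq[of i] g_eq[of j] g_eq[of l] ijl by (auto split: if_splits)
  moreover have "g i < k" "g j < k" "g l < k"
    using g_eq[of i] g_eq[of j] g_eq[of l] ijl g(2) by (auto split: if_splits)
  ultimately show ?thesis
    using k cl[of "g i" "g j" "g l"] cl[of "g l" "g i" "g j"] cl[of "g j" "g l" "g i"]
      signed_area_rot[of "vs ! g i" "vs ! g j" "vs ! g l"]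
      signed_area_rot[of "vs ! g j" "vs ! g l" "vs ! g i"]
    by cases auto
qed

section \<open>Length-preserving maps and convex edge sets\<close>

text \<open>A vertex set whose pairs have both length 1 and another length has extremal pairs, hence a
  clockwise listing. This spares a proof that points in strictly convex position can be listed.\<close>

lemma clockwise_listing_transfer:
  assumes ws: "clockwise_listing W ws" and "length ws \<ge> 4" and F: "bij_betw F W V"
    and len: "\<And>x y. \<lbrakk>x \<in> W; y \<in> W\<rbrakk> \<Longrightarrow> cyc_length W x y = cyc_length V (F x) (F y)"
  shows "\<exists>vs. clockwise_listing V vs"
proof (rule ccontr)
  assume "\<not> ?thesis"
  then have no: "extremal_pairs V = {}" unfolding extremal_pairs_def by blast
  have const: "cyc_length W x y = (LEAST k. False)" if "x \<in> W" "y \<in> W" "x \<noteq> y" for x y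
    using cyc_length_no_extremal_pairs[OF no] len that F by (metis bij_betw_def inj_onD)
  have mem: "ws ! i \<in> W" if "i < 4" for i
  proof -
    have "i < length ws" using that assms(2) by simp
    then show ?thesis using nth_mem clockwise_listingD(2)[OF ws] by metis
  qed
  have ne: "ws ! 0 \<noteq> ws ! j" if "0 < j" "j < 4" for j
  proof -
    have "j < length ws" using that assms(2) by simp
    moreover from this have "0 < length ws" by linarith
    ultimately show ?thesis
      using nth_eq_iff_index_eq[OF clockwise_listingD(1)[OF ws], of 0 j] that by simp
  qed
  have l2: "length ws \<ge> 2" using assms(2) by simp
  have "{ws ! 0, ws ! 1} \<in> extremal_pairs W"
    using extremal_pairs_iff[OF ws l2, of 0 1] assms(2) by fastforce
  \<comment> \<open>Four vertices are needed here: in a triangle every pair is extremal.\<close>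
  moreover have "{ws ! 0, ws ! 2} \<notin> extremal_pairs W"
    using extremal_pairs_iff[OF ws l2, of 0 2] assms(2) by (fastforce simp: mod_Suc numeral_eq_Suc)
  ultimately show False
    using cyc_length_eq_1_iff[OF ws l2 mem mem ne, of 1] cyc_length_eq_1_iff[OF ws l2 mem mem ne, of 2]
      const[OF mem mem ne, of 1] const[OF mem mem ne, of 2] by simp
qed

text \<open>Pairs of length 1 go to pairs of length 1, so in terms of listing indices the map is an
  injective walk around a cycle. It is a rotation, with \<open>c = 1\<close>, or a reflection, with
  \<open>c = -1\<close>.\<close>

lemma orientation_of_length_preserving:
  assumes ws: "clockwise_listing W ws" and k: "length ws \<ge> 4" and F: "bij_betw F W V"
    and len: "\<And>x y. \<lbrakk>x \<in> W; y \<in> W\<rbrakk> \<Longrightarrow> cyc_length W x y = cyc_length V (F x) (F y)"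
  shows "\<exists>c\<in>{1, -1}. \<forall>x\<in>W. \<forall>y\<in>W. \<forall>z\<in>W.
    sgn (signed_area (F x) (F y) (F z)) = c * sgn (signed_area x y z)"
proof -
  obtain vs where vs: "clockwise_listing V vs"
    using clockwise_listing_transfer[OF assms] by blast
  define k where "k = length ws"
  note wsD = clockwise_listingD[OF ws] and vsD = clockwise_listingD[OF vs]
  have inj: "inj_on F W" and FW: "F ` W = V" using F by (auto simp: bij_betw_def)
  have lvs: "length vs = k"
    using bij_betw_same_card[OF F] wsD vsD distinct_card unfolding k_def by metis
  have k2: "k \<ge> 2" using k by (simp add: k_def)
  have "\<exists>j<k. vs ! j = F (ws ! i)" if "i < k" for i
    using that FW vsD(2) wsD(2) lvs unfolding k_def by (metis imageI in_set_conv_nth nth_mem)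
  then obtain g where g: "\<And>i. i < k \<Longrightarrow> g i < k" "\<And>i. i < k \<Longrightarrow> vs ! g i = F (ws ! i)"
    by metis
  have wmem: "ws ! i \<in> W" if "i < k" for i using that wsD(2) by (auto simp: k_def)
  have vmem: "vs ! i \<in> V" if "i < k" for i using that vsD(2) lvs by auto
  have g_inj: "inj_on g {..<k}"
  proof (rule inj_onI)
    fix i j assume ij: "i \<in> {..<k}" "j \<in> {..<k}" "g i = g j"
    then have "F (ws ! i) = F (ws ! j)" using g by (metis lessThan_iff)
    then have "ws ! i = ws ! j" using inj wmem ij by (auto dest: inj_onD)
    then show "i = j" using ij wsD(1) by (simp add: k_def nth_eq_iff_index_eq)
  qed
  have step: "g (Suc i) = Suc (g i) mod k \<or> g i = Suc (g (Suc i)) mod k" if i: "Suc i < k" for i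
  proof -
    have lt: "i < k" using i by simp
    have "{ws ! i, ws ! Suc i} \<in> extremal_pairs W"
      using extremal_pairs_iff[OF ws, of i "Suc i"] i k2 by (simp add: k_def)
    moreover have "ws ! i \<noteq> ws ! Suc i"
      using wsD(1) i by (simp add: k_def nth_eq_iff_index_eq)
    ultimately have "cyc_length W (ws ! i) (ws ! Suc i) = 1"
      using cyc_length_eq_1_iff[OF ws] k2 wmem i by (simp add: k_def)
    then have "cyc_length V (vs ! g i) (vs ! g (Suc i)) = 1"
      using len wmem g i lt by simp
    moreover have "g i \<noteq> g (Suc i)" using inj_onD[OF g_inj, of i "Suc i"] i by auto
    ultimately have "{vs ! g i, vs ! g (Suc i)} \<in> extremal_pairs V"
      using cyc_length_eq_1_iff[OF vs] k2 lvs vmem g i lt vsD(1)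
      by (metis nth_eq_iff_index_eq)
    then show ?thesis using extremal_pairs_iff[OF vs, of "g i" "g (Suc i)"] k2 lvs g(1) i lt by simp
  qed
  have "\<exists>c\<in>{1, -1}. \<forall>i j l. i < j \<longrightarrow> j < l \<longrightarrow> l < k \<longrightarrow>
      sgn (signed_area (vs ! g i) (vs ! g j) (vs ! g l)) =
      c * sgn (signed_area (ws ! i) (ws ! j) (ws ! l))"
    using cyclic_walk_cases[where g = g and k = k, OF g_inj g(1) step, simplified]
  proof (elim disjE)
    assume *: "\<forall>i. Suc i < k \<longrightarrow> g (Suc i) = Suc (g i) mod k"
    have "signed_area (vs ! g i) (vs ! g j) (vs ! g l) < 0" if "i < j" "j < l" "l < k" for i j l
      using signed_area_rotated_listing[OF vs lvs[symmetric], of g i j l] * that g(1)[of 0] k2 by simp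
    then have "sgn (signed_area (vs ! g i) (vs ! g j) (vs ! g l)) =
        1 * sgn (signed_area (ws ! i) (ws ! j) (ws ! l))" if "i < j" "j < l" "l < k" for i j l
      using wsD(3)[of i j l] that by (simp add: k_def)
    then show ?thesis by blast
  next
    assume *: "\<forall>i. Suc i < k \<longrightarrow> g i = Suc (g (Suc i)) mod k"
    have "signed_area (vs ! g i) (vs ! g j) (vs ! g l) > 0" if ijl: "i < j" "j < l" "l < k" for i j l
    proof -
      \<comment> \<open>Read backwards, the walk becomes a rotation. This also reverses the order of
        each triple, which accounts for the opposite sign.\<close>
      define h where "h i = g (k - Suc i)" for i
      have h: "h (Suc i) = Suc (h i) mod k" if "Suc i < k" for i
        using * that by (simp add: h_def Suc_diff_Suc)
      have "h 0 < k" using g k2 by (simp add: h_def)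
      have "signed_area (vs ! h (k - Suc l)) (vs ! h (k - Suc j)) (vs ! h (k - Suc i)) < 0"
        using signed_area_rotated_listing[OF vs lvs[symmetric], of h] h \<open>h 0 < k\<close> ijl by simp
      then have "signed_area (vs ! g l) (vs ! g j) (vs ! g i) < 0"
        using ijl by (simp add: h_def Suc_diff_Suc)
      then show ?thesis
        using signed_area_rot[of "vs ! g i" "vs ! g j" "vs ! g l"]
          signed_area_swap[of "vs ! g l" "vs ! g j" "vs ! g i"]
          signed_area_rot[of "vs ! g j" "vs ! g l" "vs ! g i"]
          signed_area_rot[of "vs ! g l" "vs ! g i" "vs ! g j"] 
          by linarith
    qed
    then have "sgn (signed_area (vs ! g i) (vs ! g j) (vs ! g l)) =
        - 1 * sgn (signed_area (ws ! i) (ws ! j) (ws ! l))" if "i < j" "j < l" "l < k" for i j l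
      using wsD(3)[of i j l] that by (simp add: k_def)
    then show ?thesis by blast
  qed
  then obtain c where c: "c \<in> {1, -1}" and c_base: "\<And>i j l. \<lbrakk>i < j; j < l; l < k\<rbrakk> \<Longrightarrow>
      sgn (signed_area (vs ! g i) (vs ! g j) (vs ! g l)) =
      c * sgn (signed_area (ws ! i) (ws ! j) (ws ! l))"
    by blast
  have base: "sgn (signed_area (F (ws ! i)) (F (ws ! j)) (F (ws ! l))) =
      c * sgn (signed_area (ws ! i) (ws ! j) (ws ! l))" if "i < j" "j < l" "l < k" for i j l
    using c_base[OF that] g(2)[of i] g(2)[of j] g(2)[of l] that by simp
  have "sgn (signed_area (F x) (F y) (F z)) = c * sgn (signed_area x y z)"
    if "x \<in> W" "y \<in> W" "z \<in> W" for x y z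
  proof -
    have "\<exists>i<k. x = ws ! i" if "x \<in> W" for x
      using that wsD(2) unfolding k_def by (metis in_set_conv_nth)
    from this[of x] this[of y] this[of z] that
    obtain i j l where "i < k" "j < k" "l < k" "x = ws ! i" "y = ws ! j" "z = ws ! l"
      by blast
    then show ?thesis
      using signed_area_sgn_cong[of k "\<lambda>i. F (ws ! i)" c "\<lambda>i. ws ! i", OF base] by simp
  qed
  with c show ?thesis by blast
qed

text \<open>This pulls the property of having all points on one side of a chord back from
  \<open>G\<close> to a copy of \<open>G\<close> in the polygon. The sign of \<open>t\<close>
  encodes the side; a reflection replaces \<open>t\<close> by its negative.\<close>

lemma one_side_transfer:
  assumes W: "W \<subseteq> regular_polygon n" and F: "bij_betw F W V"
    and len: "\<And>x y. \<lbrakk>x \<in> W; y \<in> W\<rbrakk> \<Longrightarrow> cyc_length W x y = cyc_length V (F x) (F y)"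
    and xy: "x \<in> W" "y \<in> W" "x \<noteq> y" and Z: "Z \<subseteq> W"
    and side: "t \<noteq> 0" "\<And>z. z \<in> Z \<Longrightarrow> t * signed_area (F x) (F y) (F z) \<ge> 0"
  shows "\<exists>t::real. t \<noteq> 0 \<and> (\<forall>z\<in>Z. t * signed_area x y z \<ge> 0)"
proof -
  obtain ws where ws: "clockwise_listing W ws"
    using clockwise_listing_of_polygon_subset[OF W] by blast
  note wsD = clockwise_listingD[OF ws]
  show ?thesis
  proof (cases "length ws \<ge> 4")
    case True
    obtain c where c: "c \<in> {1, -1 :: real}" and
      sgn: "\<And>z. z \<in> W \<Longrightarrow> sgn (signed_area (F x) (F y) (F z)) = c * sgn (signed_area x y z)"
      using orientation_of_length_preserving[OF ws True F len] xy by blast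
    have "t * c * signed_area x y z \<ge> 0" if "z \<in> Z" for z
    proof -
      have "0 \<le> sgn (t * signed_area (F x) (F y) (F z))" using side that by simp
      also have "\<dots> = sgn (t * c * signed_area x y z)"
        using sgn[of z] that Z c by (auto simp: sgn_mult)
      finally show ?thesis by simp
    qed
    then show ?thesis using c side(1) by (intro exI[of _ "t * c"]) auto
  next
    case False
    have "finite W" using wsD(2) by auto
    \<comment> \<open>With at most three vertices, at most one lies off the chord, and its own side
      provides the sign.\<close>
    have "card (W - {x, y}) \<le> 1"
      using False xy wsD(1,2) distinct_card[of ws] \<open>finite W\<close> by (simp add: card_Diff_subset)
    then obtain w where "W - {x, y} \<subseteq> {w}"
      using \<open>finite W\<close> by (metis card_le_Suc0_iff_eq finite_Diff One_nat_def singleton_iff subsetI)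
    then have Z3: "z \<in> {x, y, w}" if "z \<in> Z" for z using that Z by blast
    show ?thesis
      by (intro exI[of _ "if signed_area x y w \<ge> 0 then 1 else -1"]) (auto dest!: Z3)
  qed
qed

text \<open>As functions of \<open>z\<close>, both \<open>signed_area x y z\<close> and
  \<open>a \<bullet> z - b\<close> are affine and vanish on the line through \<open>x\<close> and
  \<open>y\<close>, so they are proportional.\<close>

lemma convex_edge_set_one_side:
  assumes A: "convex_edge_set A" and e: "{x, y} \<in> A" "x \<noteq> y"
  shows "\<exists>t. t \<noteq> 0 \<and> (\<forall>z\<in>\<Union>A. t * signed_area x y z \<ge> 0)"
proof -
  obtain a b where a: "a \<noteq> 0" and hull: "affine hull {x, y} = {z. a \<bullet> z = b}"
    and side: "\<And>e'. e' \<in> A - {{x, y}} \<Longrightarrow> convex hull e' \<subseteq> {z. a \<bullet> z \<le> b}"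
    using A e unfolding convex_edge_set_def by meson
  have xy: "a \<bullet> x = b" "a \<bullet> y = b"
    using hull hull_subset[of "{x, y}" affine] by auto
  have z: "a \<bullet> z \<le> b" if "z \<in> \<Union>A" for z
  proof -
    obtain e' where e': "e' \<in> A" "z \<in> e'" using \<open>z \<in> \<Union>A\<close> by blast
    show ?thesis
    proof (cases "e' = {x, y}")
      case True
      with e' xy show ?thesis by auto
    next
      case False
      then show ?thesis using side[of e'] e' hull_subset[of e' convex] by auto
    qed
  qed
  \<comment> \<open>The normal \<open>a\<close> is orthogonal to \<open>y - x\<close>, hence
    \<open>c\<close> times its quarter turn. The factor is read off from a coordinate in which
    \<open>x\<close> and \<open>y\<close> differ.\<close>
  define c where "c = (if y $ 1 \<noteq> x $ 1 then a $ 2 / (y $ 1 - x $ 1) else - (a $ 1) / (y $ 2 - x $ 2))"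
  have in2: "a \<bullet> p = a $ 1 * p $ 1 + a $ 2 * p $ 2" for p :: point
    by (simp add: inner_vec_def sum_2)
  have orth: "a $ 1 * (y $ 1 - x $ 1) + a $ 2 * (y $ 2 - x $ 2) = 0"
    using xy by (simp add: in2 algebra_simps)
  have xy_ne: "y $ 1 \<noteq> x $ 1 \<or> y $ 2 \<noteq> x $ 2"
    using e(2) by (auto simp: vec_eq_iff forall_2)
  have a1: "a $ 1 = - c * (y $ 2 - x $ 2)" and a2: "a $ 2 = c * (y $ 1 - x $ 1)"
    using orth xy_ne by (auto simp: c_def field_simps)
  have "c \<noteq> 0" using a a1 a2 by (auto simp: vec_eq_iff forall_2)
  moreover have "- c * signed_area x y z \<ge> 0" if "z \<in> \<Union>A" for z
  proof -
    have "c * signed_area x y z = a \<bullet> z - a \<bullet> x"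
      by (simp add: in2 a1 a2 signed_area_def algebra_simps)
    then show ?thesis using z[OF that] xy by simp
  qed
  ultimately show ?thesis by (intro exI[of _ "- c"]) auto
qed

section \<open>Chord lengths\<close>

text \<open>Pairs of vertices of the complete convex geometric graph on \<open>n\<close> vertices are represented by
  pairs of indices below \<open>n\<close>.\<close>

definition chord_length :: "nat \<Rightarrow> nat set \<Rightarrow> nat" where
  "chord_length n e = min (Max e - Min e) (n - (Max e - Min e))"

lemma chord_length_pair: "i < j \<Longrightarrow> chord_length n {i, j} = min (j - i) (n - (j - i))"
  by (simp add: chord_length_def)

text \<open>The unit boundary arcs cut off by the chord \<open>e\<close> on the side not containing the other chords
  are disjoint for distinct chords \<open>e\<close>.\<close>

lemma sum_chord_length_convex:
  assumes fin: "finite A" and pair: "\<And>e. e \<in> A \<Longrightarrow> \<exists>i j. i < j \<and> j < n \<and> e = {i, j}"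
    and side: "\<And>e. e \<in> A \<Longrightarrow>
      (\<forall>z\<in>\<Union>A. Min e \<le> z \<and> z \<le> Max e) \<or> (\<forall>z\<in>\<Union>A. z \<le> Min e \<or> Max e \<le> z)"
  shows "(\<Sum>e\<in>A. chord_length n e) \<le> n"
proof -
  \<comment> \<open>An index \<open>p\<close> stands for the unit arc from vertex \<open>p\<close>
    to vertex \<open>p + 1\<close> modulo \<open>n\<close>. If no endpoint lies strictly between the
    ends of \<open>e\<close>, the inner arcs are taken, otherwise the outer ones.\<close>
  define arc where "arc e = (if \<forall>z\<in>\<Union>A. z \<le> Min e \<or> Max e \<le> z then {Min e..<Max e}
      else {..<n} - {Min e..<Max e})" for e
  have le: "chord_length n e \<le> card (arc e)" and sub: "arc e \<subseteq> {..<n}" if "e \<in> A" for e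
  proof -
    obtain i j where e: "i < j" "j < n" "e = {i, j}" using pair[OF \<open>e \<in> A\<close>] by blast
    have "card ({..<n} - {i..<j}) = n - (j - i)" using e by (subst card_Diff_subset) auto
    then show "chord_length n e \<le> card (arc e)" using e by (auto simp: arc_def chord_length_def)
    show "arc e \<subseteq> {..<n}" using e by (auto simp: arc_def)
  qed
  have in_arc: "(\<forall>z\<in>\<Union>A. z \<le> Min e \<or> Max e \<le> z) \<and> Min e \<le> p \<and> p < Max e \<or>
      (\<forall>z\<in>\<Union>A. Min e \<le> z \<and> z \<le> Max e) \<and> (p < Min e \<or> Max e \<le> p)"
    if "e \<in> A" "p \<in> arc e" for e p
  proof (cases "\<forall>z\<in>\<Union>A. z \<le> Min e \<or> Max e \<le> z")
    case True
    then have "arc e = {Min e..<Max e}" unfolding arc_def by (rule if_P)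
    then show ?thesis using that True by simp
  next
    case False
    then have "arc e = {..<n} - {Min e..<Max e}" unfolding arc_def by (rule if_not_P)
    then have "p < Min e \<or> Max e \<le> p" using that by (simp add: not_less) linarith
    then show ?thesis using side[OF \<open>e \<in> A\<close>] False by blast
  qed
  have disj: "arc e \<inter> arc e' = {}" if "e \<in> A" "e' \<in> A" "e \<noteq> e'" for e e'
  proof -
    obtain i j where e: "i < j" "j < n" "e = {i, j}" using pair[OF \<open>e \<in> A\<close>] by blast
    obtain u v where e': "u < v" "v < n" "e' = {u, v}" using pair[OF \<open>e' \<in> A\<close>] by blast
    have mm: "Min e = i" "Max e = j" "Min e' = u" "Max e' = v" using e e' by auto
    have ne: "i \<noteq> u \<or> j \<noteq> v" using e e' that by auto
    have mem: "i \<in> \<Union>A" "j \<in> \<Union>A" "u \<in> \<Union>A" "v \<in> \<Union>A" using e e' that by auto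
    show ?thesis
    proof (rule ccontr)
      assume "arc e \<inter> arc e' \<noteq> {}"
      then obtain p where p: "p \<in> arc e" "p \<in> arc e'" by blast
      \<comment> \<open>Evaluating each side condition only at the endpoints of both chords reduces
        disjointness to linear arithmetic.\<close>
      have "((u \<le> i \<or> j \<le> u) \<and> (v \<le> i \<or> j \<le> v) \<and> i \<le> p \<and> p < j) \<or>
          (i \<le> u \<and> v \<le> j \<and> (p < i \<or> j \<le> p))"
        using in_arc[OF \<open>e \<in> A\<close> p(1)] mem unfolding mm by meson
      moreover have "((i \<le> u \<or> v \<le> i) \<and> (j \<le> u \<or> v \<le> j) \<and> u \<le> p \<and> p < v) \<or>
          (u \<le> i \<and> j \<le> v \<and> (p < u \<or> v \<le> p))"
        using in_arc[OF \<open>e' \<in> A\<close> p(2)] mem unfolding mm by meson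
      ultimately show False
        using ne[unfolded linorder_neq_iff] e(1) e'(1) by (elim disjE conjE; linarith)
    qed
  qed
  have "(\<Sum>e\<in>A. chord_length n e) \<le> (\<Sum>e\<in>A. card (arc e))" by (intro sum_mono le)
  also have "\<dots> = card (\<Union>e\<in>A. arc e)"
    using fin disj finite_subset[OF sub] by (intro card_UN_disjoint[symmetric]) auto
  also have "\<dots> \<le> card {..<n}" using sub by (intro card_mono) auto
  finally show ?thesis by simp
qed

text \<open>From one of its endpoints, such a pair is completed by going \<open>d\<close> steps in
  the direction of increasing indices. It is therefore determined by one of \<open>n\<close>
  starting points.\<close>

lemma card_chord_length_eq:
  assumes pair: "\<And>e. e \<in> T \<Longrightarrow> \<exists>i j. i < j \<and> j < n \<and> e = {i, j}"
  shows "card {e \<in> T. chord_length n e = d} \<le> n"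
proof -
  have "{e \<in> T. chord_length n e = d} \<subseteq> (\<lambda>i. {i, (i + d) mod n}) ` {..<n}"
  proof
    fix e assume "e \<in> {e \<in> T. chord_length n e = d}"
    then obtain i j where e: "i < j" "j < n" "e = {i, j}" and d: "min (j - i) (n - (j - i)) = d"
      using pair[of e] chord_length_pair[of _ _ n] by auto
    show "e \<in> (\<lambda>i. {i, (i + d) mod n}) ` {..<n}"
    proof (cases "d = j - i")
      case True
      then show ?thesis using e by (intro image_eqI[of _ _ i]) auto
    next
      case False
      then have "j + d = i + n" using d e by linarith
      then show ?thesis using e by (intro image_eqI[of _ _ j]) auto
    qed
  qed
  then have "card {e \<in> T. chord_length n e = d} \<le> card ((\<lambda>i. {i, (i + d) mod n}) ` {..<n})"
    by (intro card_mono) auto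
  also have "\<dots> \<le> n" using card_image_le[of "{..<n}"] by simp
  finally show ?thesis .
qed

text \<open>Only \<open>n\<close> pairs have a given length, so \<open>K * card T\<close> exceeds the total length by at most
  \<open>n * (\<Sum>d = 1..K. K - d)\<close>. The threshold \<open>K = \<lceil>card T / n\<rceil>\<close> is optimal.\<close>

lemma sum_chord_length_lower:
  assumes fin: "finite T" and n: "n > 0"
    and pair: "\<And>e. e \<in> T \<Longrightarrow> \<exists>i j. i < j \<and> j < n \<and> e = {i, j}"
  shows "(\<Sum>e\<in>T. real (chord_length n e)) \<ge> real (card T) ^ 2 / (2 * real n)"
proof -
  define L where "L = chord_length n"
  define x where "x = real (card T) / real n"
  define K where "K = nat \<lceil>x\<rceil>"
  have L1: "L e \<ge> 1" if "e \<in> T" for e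
    using pair[OF that] by (auto simp: L_def chord_length_pair)
  \<comment> \<open>Truncated subtraction of naturals only enlarges the terms and annihilates all
    pairs longer than \<open>K\<close>. The remaining ones are grouped by their length
    \<open>d\<close>.\<close>
  have "(\<Sum>e\<in>T. real K - real (L e)) \<le> (\<Sum>e\<in>T. real (K - L e))"
    by (intro sum_mono) auto
  also have "\<dots> = (\<Sum>e | e \<in> T \<and> L e \<in> {1..K}. real (K - L e))"
    using fin L1 by (intro sum.mono_neutral_right) auto
  also have "\<dots> = (\<Sum>d\<in>{1..K}. \<Sum>e | e \<in> {e \<in> T. L e \<in> {1..K}} \<and> L e = d. real (K - L e))"
    using fin by (intro sum.group[symmetric]) auto
  also have "\<dots> \<le> (\<Sum>d\<in>{1..K}. real n * real (K - d))"
  proof (rule sum_mono)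
    fix d assume "d \<in> {1..K}"
    then have "{e \<in> {e \<in> T. L e \<in> {1..K}}. L e = d} = {e \<in> T. L e = d}" by auto
    then have "(\<Sum>e | e \<in> {e \<in> T. L e \<in> {1..K}} \<and> L e = d. real (K - L e)) =
      real (card {e \<in> T. L e = d}) * real (K - d)" by simp
    also have "\<dots> \<le> real n * real (K - d)"
      using card_chord_length_eq[of T n d] pair unfolding L_def by (intro mult_right_mono) auto
    finally show "(\<Sum>e | e \<in> {e \<in> T. L e \<in> {1..K}} \<and> L e = d. real (K - L e)) \<le> real n * real (K - d)" .
  qed
  also have "\<dots> = real n * (real K * (real K - 1) / 2)"
  proof -
    have "(\<Sum>d\<in>{1..K}. real (K - d)) = (\<Sum>d<K. real d)"
      by (rule sum.reindex_bij_witness[of _ "\<lambda>d. K - d" "\<lambda>d. K - d"]) auto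
    also have "\<dots> = real K * (real K - 1) / 2"
      by (induction K) (auto simp: field_simps)
    finally show ?thesis by (simp flip: sum_distrib_left)
  qed
  finally have "real (card T) * real K - (\<Sum>e\<in>T. real (L e)) \<le> real n * (real K * (real K - 1) / 2)"
    by (simp add: sum_subtractf)
  moreover have "real n * (x * K - K * (real K - 1) / 2) =
      real (card T) * real K - real n * (real K * (real K - 1) / 2)"
    using n by (simp add: x_def right_diff_distrib)
  ultimately have "(\<Sum>e\<in>T. real (L e)) \<ge> real n * (x * K - K * (real K - 1) / 2)"
    by linarith
  moreover have "x * K - K * (real K - 1) / 2 \<ge> x\<^sup>2 / 2"
  proof -
    have "x \<ge> 0" by (simp add: x_def)
    then have "x \<le> K" "K \<le> x + 1"
      unfolding K_def by (simp_all add: real_nat_ceiling_ge)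
    \<comment> \<open>The rounding error \<open>K - x\<close> lies between 0 and 1. Up to the factor
      1/2, the slack in the claimed bound is this product plus \<open>x\<close>.\<close>
    then have "(real K - x) * (1 - (real K - x)) \<ge> 0" by (intro mult_nonneg_nonneg) auto
    moreover have "x * K - K * (real K - 1) / 2 - x\<^sup>2 / 2 =
        ((real K - x) * (1 - (real K - x)) + x) / 2"
      by (simp add: power2_eq_square field_simps)
    ultimately show ?thesis using \<open>x \<ge> 0\<close> by simp
  qed
  then have "real n * (x * K - K * (real K - 1) / 2) \<ge> real n * (x\<^sup>2 / 2)"
    by (rule mult_left_mono) simp
  ultimately have "(\<Sum>e\<in>T. real (L e)) \<ge> real n * (x\<^sup>2 / 2)" by linarith
  then show ?thesis using n by (simp add: x_def L_def power2_eq_square field_simps)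
qed

text \<open>Bolzano-Weierstrass is applied to one index at a time. Each refinement keeps the
  convergence already obtained for the earlier indices.\<close>

lemma finite_convergent_subsequence:
  fixes f :: "nat \<Rightarrow> 'a \<Rightarrow> real"
  assumes "finite E" and "\<And>e. e \<in> E \<Longrightarrow> bounded (range (\<lambda>n. f n e))"
  shows "\<exists>r. strict_mono r \<and> (\<forall>e\<in>E. convergent (\<lambda>n. f (r n) e))"
  using assms
proof (induction E)
  case empty
  then show ?case using strict_mono_id by auto
next
  case (insert a E)
  then obtain r where r: "strict_mono r" "\<forall>e\<in>E. convergent (\<lambda>n. f (r n) e)" by auto
  have "bounded (range (\<lambda>n. f (r n) a))"
    using insert.prems by (rule bounded_subset) auto
  then obtain l s where s: "strict_mono s" "((\<lambda>n. f (r n) a) \<circ> s) \<longlonglongrightarrow> l"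
    using bounded_imp_convergent_subsequence by blast
  have "convergent (\<lambda>n. f ((r \<circ> s) n) e)" if "e \<in> insert a E" for e
  proof (cases "e = a")
    case True
    then show ?thesis using s by (auto simp: convergent_def o_def)
  next
    case False
    then show ?thesis using r(2) that convergent_subseq_convergent[OF _ s(1)] by (fastforce simp: o_def)
  qed
  moreover have "strict_mono (r \<circ> s)" using r s by (simp add: strict_mono_o)
  ultimately show ?case by blast
qed

section \<open>Packings\<close>

lemma finite_edges: "cgg G \<Longrightarrow> finite (edges G)"
  unfolding cgg_def all_pairs_def
  by (rule finite_subset[of _ "Pow (verts G)"]) auto

lemma edgeE:
  assumes "cgg G" "e \<in> edges G"
  obtains x y where "e = {x, y}" "x \<in> verts G" "y \<in> verts G" "x \<noteq> y"
  using assms unfolding cgg_def all_pairs_def by blast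

text \<open>This collects all that is used about one copy. The isomorphism runs from
  \<open>H\<close> to \<open>G\<close>, so \<open>h\<close> sends a vertex of \<open>G\<close>
  through the inverse to the index of its polygon vertex. For a convex edge set, sidedness passes
  from \<open>G\<close> to \<open>H\<close>, then to index intervals, where the disjoint-arc bound
  applies.\<close>

lemma copy_index_map:
  assumes G: "cgg G" and sub: "cgg_subgraph H (complete_cgg n)" and iso: "convex_isomorphic H G"
  shows "\<exists>h. inj_on h (verts G) \<and> h ` verts G \<subseteq> {..<n} \<and>
    (\<forall>e\<in>edges G. polygon_vertex n ` h ` e \<in> edges H) \<and>
    (\<forall>A. A \<subseteq> edges G \<and> convex_edge_set A \<longrightarrow> (\<Sum>e\<in>A. chord_length n (h ` e)) \<le> n)"
proof -
  define V W where "V = verts G" and "W = verts H"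
  obtain F where F: "bij_betw F W V"
    and len: "\<And>x y. \<lbrakk>x \<in> W; y \<in> W\<rbrakk> \<Longrightarrow> cyc_length W x y = cyc_length V (F x) (F y)"
    and edge: "\<And>x y. \<lbrakk>x \<in> W; y \<in> W\<rbrakk> \<Longrightarrow> {x, y} \<in> edges H \<longleftrightarrow> {F x, F y} \<in> edges G"
    using iso unfolding convex_isomorphic_def V_def W_def by blast
  have W: "W \<subseteq> regular_polygon n"
    using sub by (simp add: cgg_subgraph_def complete_cgg_def W_def)
  define F' where "F' = inv_into W F"
  define idx where "idx = inv_into {..<n} (polygon_vertex n)"
  define h where "h = idx \<circ> F'"
  have F': "F' v \<in> W" "F (F' v) = v" if "v \<in> V" for v
    using that F bij_betw_inv_into_right[OF F] unfolding F'_def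
    by (auto simp: bij_betw_def inv_into_into)
  have q: "polygon_vertex n (idx w) = w" "idx w < n" if "w \<in> W" for w
    using that W f_inv_into_f[of w "polygon_vertex n" "{..<n}"]
      inv_into_into[of w "polygon_vertex n" "{..<n}"]
    unfolding regular_polygon_eq idx_def by auto
  have qh: "polygon_vertex n (h v) = F' v" "h v < n" if "v \<in> V" for v
    using q[OF F'(1)[OF that]] by (simp_all add: h_def)
  have inj: "inj_on h V"
    by (rule inj_onI) (metis qh(1) F'(2))
  moreover have "h ` V \<subseteq> {..<n}" using qh by auto
  moreover have "polygon_vertex n ` h ` e \<in> edges H" if e: "e \<in> edges G" for e
  proof -
    obtain x y where xy: "e = {x, y}" "x \<in> V" "y \<in> V"
      using edgeE[OF G e] unfolding V_def by metis
    then show ?thesis using edge[of "F' x" "F' y"] F' qh e by simp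
  qed
  moreover have "(\<Sum>e\<in>A. chord_length n (h ` e)) \<le> n"
    if A: "A \<subseteq> edges G" "convex_edge_set A" for A
  proof -
    have AV: "\<Union>A \<subseteq> V" using A(1) G by (auto simp: V_def elim!: edgeE)
    then have "inj_on ((`) h) A" by (intro inj_on_image inj_on_subset[OF inj])
    then have "(\<Sum>e\<in>A. chord_length n (h ` e)) = (\<Sum>e\<in>(`) h ` A. chord_length n e)"
      by (simp add: sum.reindex)
    also have "\<dots> \<le> n"
    proof (rule sum_chord_length_convex)
      show "finite ((`) h ` A)" using A(1) finite_edges[OF G] finite_subset by blast
    next
      have ordered: "\<exists>x y. {x, y} \<in> A \<and> x \<in> V \<and> y \<in> V \<and> e = {h x, h y} \<and> h x < h y"
        if e: "e \<in> (`) h ` A" for e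
      proof -
        obtain e0 where e0: "e0 \<in> A" "e = h ` e0" using e by blast
        then obtain x y where xy: "e0 = {x, y}" "x \<in> V" "y \<in> V" "x \<noteq> y"
          using A(1) edgeE[OF G] unfolding V_def by (metis subsetD)
        then have "h x < h y \<or> h y < h x" using inj by (metis inj_onD linorder_neqE_nat)
        then show ?thesis
        proof
          assume "h x < h y"
          with e0 xy show ?thesis by (intro exI[of _ x] exI[of _ y]) auto
        next
          assume "h y < h x"
          with e0 xy show ?thesis by (intro exI[of _ y] exI[of _ x]) (auto simp: insert_commute)
        qed
      qed
      show "\<exists>i j. i < j \<and> j < n \<and> e = {i, j}" if "e \<in> (`) h ` A" for e
        using ordered[OF that] qh by blast
      show "(\<forall>z\<in>\<Union>((`) h ` A). Min e \<le> z \<and> z \<le> Max e) \<or>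
          (\<forall>z\<in>\<Union>((`) h ` A). z \<le> Min e \<or> Max e \<le> z)" if e: "e \<in> (`) h ` A" for e
      proof -
        obtain x y where xy: "{x, y} \<in> A" "x \<in> V" "y \<in> V" "e = {h x, h y}" "h x < h y"
          using ordered[OF e] by blast
        have mm: "Min e = h x" "Max e = h y" using xy by auto
        have "x \<noteq> y" using xy by auto
        then obtain t0 where t0: "t0 \<noteq> 0" "\<And>z. z \<in> \<Union>A \<Longrightarrow> t0 * signed_area x y z \<ge> 0"
          using convex_edge_set_one_side[OF A(2) xy(1)] by blast
        have "\<exists>t. t \<noteq> 0 \<and> (\<forall>z\<in>F' ` \<Union>A. t * signed_area (F' x) (F' y) z \<ge> 0)"
        proof (rule one_side_transfer[OF W F len _ _ _ _ t0(1)])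
          show "F' x \<noteq> F' y" using F'(2) xy \<open>x \<noteq> y\<close> by metis
          show "0 \<le> t0 * signed_area (F (F' x)) (F (F' y)) (F z)" if z: "z \<in> F' ` \<Union>A" for z
          proof -
            obtain v where v: "v \<in> \<Union>A" "z = F' v" using z by blast
            then have "F z = v" "F (F' x) = x" "F (F' y) = y" using AV F'(2) xy by blast+
            then show ?thesis using t0(2)[OF v(1)] by simp
          qed
        qed (use F'(1) xy AV in auto)
        then obtain t where t: "t \<noteq> 0" "\<And>z. z \<in> F' ` \<Union>A \<Longrightarrow> t * signed_area (F' x) (F' y) z \<ge> 0"
          by blast
        have sgn: "t * signed_area (polygon_vertex n (h x)) (polygon_vertex n (h y))
            (polygon_vertex n z) \<ge> 0" and zn: "z < n" if z: "z \<in> \<Union>((`) h ` A)" for z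
        proof -
          obtain v where v: "v \<in> \<Union>A" "z = h v" using z by blast
          then have "v \<in> V" using AV by blast
          then show "t * signed_area (polygon_vertex n (h x)) (polygon_vertex n (h y))
            (polygon_vertex n z) \<ge> 0" "z < n" using t(2)[of "F' v"] v qh xy by auto
        qed
        \<comment> \<open>Since indices run counterclockwise, a positive \<open>t\<close> keeps
          every index out of the open interval from \<open>h x\<close> to \<open>h y\<close>, and a
          negative \<open>t\<close> keeps it inside the closed one.\<close>
        show ?thesis
        proof (cases "t > 0")
          case True
          have "z \<le> h x \<or> h y \<le> z" if z: "z \<in> \<Union>((`) h ` A)" for z
          proof (rule ccontr)
            assume "\<not> ?thesis"
            then have "signed_area (polygon_vertex n (h x)) (polygon_vertex n z) (polygon_vertex n (h y)) > 0"
              using signed_area_polygon[of "h x" z "h y" n] qh xy by simp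
            moreover have "signed_area (polygon_vertex n (h x)) (polygon_vertex n (h y)) (polygon_vertex n z) \<ge> 0"
              using sgn[OF z] True by (simp add: zero_le_mult_iff)
            ultimately show False
              using signed_area_rot[of "polygon_vertex n (h x)" "polygon_vertex n z" "polygon_vertex n (h y)"]
                signed_area_swap[of "polygon_vertex n (h x)" "polygon_vertex n (h y)" "polygon_vertex n z"]
              by linarith
          qed
          then show ?thesis unfolding mm by blast
        next
          case False
          then have "t < 0" using t(1) by simp
          have "h x \<le> z \<and> z \<le> h y" if z: "z \<in> \<Union>((`) h ` A)" for z
          proof (rule ccontr)
            assume "\<not> ?thesis"
            then have "signed_area (polygon_vertex n (h x)) (polygon_vertex n (h y)) (polygon_vertex n z) > 0"
              using signed_area_polygon[of "h x" "h y" z n] signed_area_polygon[of z "h x" "h y" n]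
                signed_area_rot[of "polygon_vertex n (h x)" "polygon_vertex n (h y)" "polygon_vertex n z"]
                qh xy zn[OF z] by auto
            then show False using sgn[OF z] \<open>t < 0\<close> by (simp add: zero_le_mult_iff)
          qed
          then show ?thesis unfolding mm by blast
        qed
      qed
    qed
    finally show ?thesis .
  qed
  ultimately show ?thesis unfolding V_def by blast
qed

text \<open>A complete convex geometric graph has finitely many subgraphs, hence finitely many
  packings, and the empty packing is one of them. So the \<open>Max\<close> in
  \<open>packing_number\<close> is a genuine maximum.\<close>

lemma packing_number_attained: "\<exists>P. is_packing G n P \<and> finite P \<and> card P = packing_number n G"
proof -
  let ?K = "complete_cgg n"
  have "{H. cgg_subgraph H ?K} \<subseteq>
      (\<lambda>(V, E). \<lparr>verts = V, edges = E\<rparr>) ` (Pow (verts ?K) \<times> Pow (edges ?K))"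
  proof
    fix H :: geo_graph assume "H \<in> {H. cgg_subgraph H ?K}"
    then show "H \<in> (\<lambda>(V, E). \<lparr>verts = V, edges = E\<rparr>) ` (Pow (verts ?K) \<times> Pow (edges ?K))"
      by (intro image_eqI[of _ _ "(verts H, edges H)"]) (auto simp: cgg_subgraph_def)
  qed
  moreover have "finite (verts ?K)" by (simp add: complete_cgg_def regular_polygon_def)
  moreover have "finite (edges ?K)"
    by (rule finite_subset[of _ "Pow (verts ?K)"])
      (use \<open>finite (verts ?K)\<close> in \<open>auto simp: complete_cgg_def all_pairs_def\<close>)
  ultimately have fin: "finite {H. cgg_subgraph H ?K}"
    by (meson finite_Pow_iff finite_SigmaI finite_imageI finite_subset)
  have sub: "{P. is_packing G n P} \<subseteq> Pow {H. cgg_subgraph H ?K}"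
    by (auto simp: is_packing_def)
  have "finite {P. is_packing G n P}" using finite_subset[OF sub] fin by simp
  moreover have "{} \<in> {P. is_packing G n P}" by (simp add: is_packing_def)
  ultimately have "packing_number n G \<in> card ` {P. is_packing G n P}"
    unfolding packing_number_def by (intro Max_in) auto
  then obtain P where P: "is_packing G n P" "packing_number n G = card P" by blast
  then have "finite P" using sub fin finite_subset by blast
  with P show ?thesis by auto
qed

text \<open>Both sum conditions hold exactly for each \<open>n\<close>; only the constant in the
  first depends on \<open>n\<close>. It arises by dividing the bound for \<open>card S * p\<close>
  distinct pairs by the normalisation \<open>n * p\<close>.\<close>

lemma packing_edge_weights:
  assumes G: "cgg G"
  shows "\<exists>f. (\<forall>e\<in>edges G. 0 \<le> f e \<and> f e \<le> 1) \<and>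
    (\<forall>S. S \<subseteq> edges G \<longrightarrow>
      (\<Sum>e\<in>S. f e) \<ge> real (card S) ^ 2 * (real (packing_number n G) / (2 * real n ^ 2))) \<and>
    (\<forall>A. A \<subseteq> edges G \<and> convex_edge_set A \<longrightarrow> (\<Sum>e\<in>A. f e) \<le> 1)"
proof -
  define p where "p = packing_number n G"
  obtain P where P: "is_packing G n P" "finite P" "card P = p"
    using packing_number_attained unfolding p_def by blast
  show ?thesis
  proof (cases "n = 0 \<or> p = 0")
    case True
    \<comment> \<open>The zero weight suffices, because the lower bound is then 0; for
      \<open>n = 0\<close> this uses that division by zero gives 0.\<close>
    then show ?thesis by (intro exI[of _ "\<lambda>_. 0"]) (auto simp: p_def)
  next
    case False
    then have n: "n > 0" and p: "p > 0" by auto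
    define good where "good H h \<longleftrightarrow> inj_on h (verts G) \<and> h ` verts G \<subseteq> {..<n} \<and>
      (\<forall>e\<in>edges G. polygon_vertex n ` h ` e \<in> edges H) \<and>
      (\<forall>A. A \<subseteq> edges G \<and> convex_edge_set A \<longrightarrow> (\<Sum>e\<in>A. chord_length n (h ` e)) \<le> n)"
      for H :: geo_graph and h
    have "\<forall>H\<in>P. \<exists>h. good H h"
    proof
      fix H assume "H \<in> P"
      then show "\<exists>h. good H h"
        using P(1) unfolding good_def is_packing_def by (intro copy_index_map[OF G]) auto
    qed
    then obtain h where good: "good H (h H)" if "H \<in> P" for H
      using bchoice[of P good] by blast
    have h: "inj_on (h H) (verts G)" "h H ` verts G \<subseteq> {..<n}"
        "\<And>e. e \<in> edges G \<Longrightarrow> polygon_vertex n ` h H ` e \<in> edges H"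
        "\<And>A. \<lbrakk>A \<subseteq> edges G; convex_edge_set A\<rbrakk> \<Longrightarrow>
          (\<Sum>e\<in>A. chord_length n (h H ` e)) \<le> n" if "H \<in> P" for H
      using good[OF that] unfolding good_def by simp_all
    define L where "L e H = real (chord_length n (h H ` e))" for e H
    define f where "f e = (\<Sum>H\<in>P. L e H) / (real n * real p)" for e
    have np: "real n * real p > 0" using n p by simp
    have sum_f: "(\<Sum>e\<in>S. f e) = (\<Sum>e\<in>S. \<Sum>H\<in>P. L e H) / (real n * real p)" for S
      by (simp add: f_def sum_divide_distrib)
    have "0 \<le> f e \<and> f e \<le> 1" for e
    proof -
      have "(\<Sum>H\<in>P. L e H) \<le> (\<Sum>H\<in>P. real n)"
        by (intro sum_mono) (simp add: L_def chord_length_def min_le_iff_disj)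
      then have "f e \<le> 1" using np P(3) by (simp add: f_def mult.commute)
      then show ?thesis by (simp add: f_def L_def sum_nonneg)
    qed
    moreover have "(\<Sum>e\<in>A. f e) \<le> 1" if A: "A \<subseteq> edges G" "convex_edge_set A" for A
    proof -
      have "(\<Sum>e\<in>A. \<Sum>H\<in>P. L e H) = (\<Sum>H\<in>P. \<Sum>e\<in>A. L e H)" by (rule sum.swap)
      also have "\<dots> \<le> (\<Sum>H\<in>P. real n)"
      proof (rule sum_mono)
        fix H assume "H \<in> P"
        then have "real (\<Sum>e\<in>A. chord_length n (h H ` e)) \<le> real n"
          using h(4) A by (intro of_nat_mono) blast
        then show "(\<Sum>e\<in>A. L e H) \<le> real n" by (simp add: L_def)
      qed
      also have "\<dots> = real n * real p" using P(3) by simp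
      finally show ?thesis using np by (simp add: sum_f)
    qed
    moreover have "(\<Sum>e\<in>S. f e) \<ge> real (card S) ^ 2 * (real p / (2 * real n ^ 2))"
      if S: "S \<subseteq> edges G" for S
    proof -
      define \<phi> where "\<phi> = (\<lambda>(e, H). h H ` e)"
      have fin: "finite (S \<times> P)" using S finite_edges[OF G] P(2) finite_subset by blast
      \<comment> \<open>Edge-disjointness of the copies recovers \<open>H\<close> from a common
        image, and then injectivity of \<open>h H\<close> on vertices recovers
        \<open>e\<close>.\<close>
      have inj: "inj_on \<phi> (S \<times> P)"
      proof (rule inj_onI, clarify)
        fix e H e' H' assume *: "e \<in> S" "H \<in> P" "e' \<in> S" "H' \<in> P" "\<phi> (e, H) = \<phi> (e', H')"
        then have "polygon_vertex n ` h H ` e \<in> edges H \<inter> edges H'"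
          using h(3)[of H e] h(3)[of H' e'] S by (auto simp: \<phi>_def)
        then have "H = H'" using P(1) * unfolding is_packing_def by blast
        moreover have "e \<subseteq> verts G" "e' \<subseteq> verts G"
          using * S G by (auto simp: cgg_def all_pairs_def)
        ultimately show "e = e' \<and> H = H'"
          using * h(1) inj_on_image_eq_iff by (fastforce simp: \<phi>_def)
      qed
      have "\<exists>i j. i < j \<and> j < n \<and> c = {i, j}" if c: "c \<in> \<phi> ` (S \<times> P)" for c
      proof -
        obtain e H where e: "e \<in> S" "H \<in> P" "c = h H ` e" using c by (auto simp: \<phi>_def)
        then obtain x y where xy: "e = {x, y}" "x \<in> verts G" "y \<in> verts G" "x \<noteq> y"
          using S edgeE[OF G] by (metis subsetD)
        then have "h H x < n" "h H y < n" "h H x < h H y \<or> h H y < h H x"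
          using h(1,2)[OF e(2)] by (auto simp: linorder_neq_iff[symmetric] dest: inj_onD)
        moreover have "c = {h H x, h H y}" "c = {h H y, h H x}" using e xy by auto
        ultimately show ?thesis by blast
      qed
      then have "(\<Sum>c\<in>\<phi> ` (S \<times> P). real (chord_length n c)) \<ge>
          real (card (\<phi> ` (S \<times> P))) ^ 2 / (2 * real n)"
        using fin n by (intro sum_chord_length_lower) auto
      moreover have "(\<Sum>c\<in>\<phi> ` (S \<times> P). real (chord_length n c)) = (\<Sum>e\<in>S. \<Sum>H\<in>P. L e H)"
        unfolding sum.reindex[OF inj] sum.cartesian_product
        by (intro sum.cong) (auto simp: \<phi>_def L_def)
      moreover have "card (\<phi> ` (S \<times> P)) = card S * p"
        using card_image[OF inj] P(3) by (simp add: card_cartesian_product)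
      ultimately have "(real (card S) * real p) ^ 2 / (2 * real n) \<le> (\<Sum>e\<in>S. \<Sum>H\<in>P. L e H)"
        by simp
      then have "(real (card S) * real p) ^ 2 / (2 * real n) / (real n * real p) \<le> (\<Sum>e\<in>S. f e)"
        unfolding sum_f using np by (intro divide_right_mono) auto
      then show ?thesis using n p by (simp add: power2_eq_square field_simps)
    qed
    ultimately show ?thesis unfolding p_def by blast
  qed
qed

section \<open>Passage to the limit\<close>

lemma packing_number_asymptotics:
  assumes "convex_packable G" and m: "card (edges G) > 0"
  shows "(\<lambda>n. real (packing_number n G) / (2 * real n ^ 2)) \<longlonglongrightarrow> 1 / (4 * real (card (edges G)))"
proof -
  define m where "m = real (card (edges G))"
  have "m > 0" using m by (simp add: m_def)
  let ?a = "\<lambda>n. real (packing_number n G) * m / real (n choose 2)"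
  \<comment> \<open>The extra factor is \<open>n choose 2\<close> divided by
    \<open>2 * n^2 * m\<close>; it converts the packing density into the constant of the finite
    bound.\<close>
  have "(\<lambda>n. ?a n * ((1 - 1 / real n) / (4 * m))) \<longlonglongrightarrow> 1 * ((1 - 0) / (4 * m))"
    using assms(1) \<open>m > 0\<close> unfolding convex_packable_def m_def
    by (intro tendsto_intros lim_1_over_n) auto
  moreover have "eventually (\<lambda>n. ?a n * ((1 - 1 / real n) / (4 * m)) =
      real (packing_number n G) / (2 * real n ^ 2)) sequentially"
    using eventually_ge_at_top[of 2]
  proof eventually_elim
    case (elim n)
    have choose: "real (n choose 2) = real n * (real n - 1) / 2"
      using elim by (simp add: choose_two real_of_nat_div of_nat_diff)
    have "real n > 0" "real n - 1 > 0" using elim by simp_all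
    then show ?case
      unfolding choose using \<open>m > 0\<close> by (simp add: divide_simps power2_eq_square)
  qed
  ultimately have "(\<lambda>n. real (packing_number n G) / (2 * real n ^ 2)) \<longlonglongrightarrow> 1 * ((1 - 0) / (4 * m))"
    by (rule Lim_transform_eventually)
  then show ?thesis by (simp add: m_def)
qed

theorem lemma5:
  fixes G :: geo_graph
  assumes "cgg G"
    and "convex_packable G"
  shows "\<exists>f :: point set \<Rightarrow> real.
    (\<forall>e\<in>edges G. f e > 0) \<and>
    (\<forall>S. S \<subseteq> edges G \<longrightarrow>
      (\<Sum>e\<in>S. f e) \<ge> real (card S) ^ 2 / (4 * real (card (edges G)))) \<and>
    (\<forall>A. A \<subseteq> edges G \<and> convex_edge_set A \<longrightarrow> (\<Sum>e\<in>A. f e) \<le> 1)"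
proof (cases "edges G = {}")
  case True
  \<comment> \<open>All sums are empty and the lower bound is 0 / 0, which evaluates to 0.\<close>
  then show ?thesis by simp
next
  case False
  define m where "m = real (card (edges G))"
  have fin: "finite (edges G)" using finite_edges assms(1) .
  with False have m: "card (edges G) > 0" by (simp add: card_gt_0_iff)
  define b where "b n = real (packing_number n G) / (2 * real n ^ 2)" for n
  have b: "b \<longlonglongrightarrow> 1 / (4 * m)"
    using packing_number_asymptotics[OF assms(2) m] by (simp add: b_def[abs_def] m_def)
  obtain F where F: "\<And>n e. e \<in> edges G \<Longrightarrow> 0 \<le> F n e \<and> F n e \<le> 1"
    and lower: "\<And>n S. S \<subseteq> edges G \<Longrightarrow> real (card S) ^ 2 * b n \<le> (\<Sum>e\<in>S. F n e)"
    and upper: "\<And>n A. \<lbrakk>A \<subseteq> edges G; convex_edge_set A\<rbrakk> \<Longrightarrow> (\<Sum>e\<in>A. F n e) \<le> 1"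
    using packing_edge_weights[OF assms(1)] unfolding b_def by metis
  have "bounded (range (\<lambda>n. F n e))" if "e \<in> edges G" for e
    using F[OF that] by (intro boundedI[of _ 1]) auto
  then obtain r where r: "strict_mono r" "\<forall>e\<in>edges G. convergent (\<lambda>n. F (r n) e)"
    using finite_convergent_subsequence[OF fin, of F] by blast
  define f where "f e = lim (\<lambda>n. F (r n) e)" for e
  \<comment> \<open>One subsequence serves all edges, so the limit may be taken inside every finite
    sum at once.\<close>
  have lim: "(\<lambda>n. \<Sum>e\<in>S. F (r n) e) \<longlonglongrightarrow> (\<Sum>e\<in>S. f e)" if "S \<subseteq> edges G" for S
    using r(2) that by (intro tendsto_sum) (auto simp: f_def convergent_LIMSEQ_iff)
  have br: "(\<lambda>n. b (r n)) \<longlonglongrightarrow> 1 / (4 * m)"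
    using LIMSEQ_subseq_LIMSEQ[OF b r(1)] by (simp add: o_def)
  have f_lower: "real (card S) ^ 2 / (4 * m) \<le> (\<Sum>e\<in>S. f e)" if "S \<subseteq> edges G" for S
  proof -
    have "real (card S) ^ 2 * (1 / (4 * m)) \<le> (\<Sum>e\<in>S. f e)"
      by (rule LIMSEQ_le[OF tendsto_mult_left[OF br] lim[OF that]]) (use lower that in blast)
    then show ?thesis by simp
  qed
  have f_upper: "(\<Sum>e\<in>A. f e) \<le> 1" if "A \<subseteq> edges G" "convex_edge_set A" for A
    by (rule LIMSEQ_le_const2[OF lim[OF that(1)]]) (use upper that in blast)
  \<comment> \<open>Strict positivity need not survive a limit. It comes from the lower bound for a
    single edge, which is \<open>1 / (4 * m)\<close>.\<close>
  have "f e > 0" if "e \<in> edges G" for e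
    using f_lower[of "{e}"] that m by (auto simp: m_def intro: less_le_trans[rotated])
  with f_lower f_upper show ?thesis unfolding m_def by blast
qed

end
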